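(* Let $G$ be the Cayley graph (with respect to a finite symmetric generating set) of a finitely generated group with polynomial growth of order $d$. Then $G$ does not have the $\{f(n)\}$-retaining property for any $f(n)=o(n^{d-2})$.
   Context: Let $G$ be a finitely generated group with finite symmetric generating set $S$; its Cayley graph has vertex set $G$ and edges $x\sim xs$, $s\in S$. Let $B_n$ be the ball of radius $n$ around the identity for the graph distance and $v_G(n)=|B_n|$. The group has polynomial growth of order $d$ if $v_G(n)/n^d$ is bounded above and below by positive constants for $n\ge 1$. Fire process: let $f$ be a sequence of non-negative integers $f(n)$, $n\ge 1$. A fire breaks out at time $0$ on a finite set $F_0\subset G$. At each time $n\ge 1$ a set $W_n$ of at most $f(n)$ vertices not on fire (that is, $W_n\cap F_{n-1}=\emptyset$) is declared protected forever, and then the fire spreads to all unprotected neighbors: $F_n=F_{n-1}\cup\{x : x\sim y \text{ for some } y\in F_{n-1},\ x\notin W_1\cup\dots\cup W_n\}$. Such a sequence $\{W_n\}_{n\ge1}$ is called an $\{f(n)\}$-allowed strategy. Let $U=G\setminus\bigcup_n F_n$ be the set of vertices that are never on fire. $G$ has the $\{f(n)\}$-retaining (or retainment) property if for every finite $F_0\subset G$ there is an $\{f(n)\}$-allowed strategy such that the function $n\mapsto |U\cap B_n|$ is equivalent to $v_G$, where $a\preceq b$ means that there is a constant $C>0$ with $a(n)\le C\,b(Cn)+C$ for all $n$, and $a,b$ are equivalent if $a\preceq b$ and $b\preceq a$. For $G$ of polynomial growth this means: for every finite $F_0$ there exist $c=c(F_0)>0$ and an $\{f(n)\}$-allowed strategy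 with $|U\cap B_n|\ge c\,v_G(n)$ for all $n$ large enough.
   Formalization: The case d = 1 is excluded, since the claim fails there: on the integers with generators ±1, f(1) = 2 and f(n) = 0 for n ≥ 2 is o(n^{-1}), yet protecting both ends of an interval containing the fire at time 1 saves all but finitely many vertices. *)

theory Defs
  imports "HOL-Algebra.Generated_Groups" "HOL-Library.Landau_Symbols" Complex_Main
begin

definition cayley_edges :: "('a, 'b) monoid_scheme \<Rightarrow> 'a set \<Rightarrow> ('a \<times> 'a) set" where
  "cayley_edges G S = {(x, x \<otimes>\<^bsub>G\<^esub> s) | x s. x \<in> carrier G \<and> s \<in> S}"

text \<open>Length of a shortest path; only meaningful when a path exists, which holds for all
  pairs of vertices as soon as \<open>S\<close> is a symmetric generating set.\<close>

definition cayley_dist :: "('a, 'b) monoid_scheme \<Rightarrow> 'a set \<Rightarrow> 'a \<Rightarrow> 'a \<Rightarrow> nat" where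
  "cayley_dist G S x y = (LEAST k. (x, y) \<in> cayley_edges G S ^^ k)"

definition cayley_ball :: "('a, 'b) monoid_scheme \<Rightarrow> 'a set \<Rightarrow> nat \<Rightarrow> 'a set" where
  "cayley_ball G S n = {x \<in> carrier G. cayley_dist G S \<one>\<^bsub>G\<^esub> x \<le> n}"

definition growth :: "('a, 'b) monoid_scheme \<Rightarrow> 'a set \<Rightarrow> nat \<Rightarrow> nat" where
  "growth G S n = card (cayley_ball G S n)"

definition polynomial_growth :: "('a, 'b) monoid_scheme \<Rightarrow> 'a set \<Rightarrow> real \<Rightarrow> bool" where
  "polynomial_growth G S d \<longleftrightarrow>
    (\<exists>c C. c > 0 \<and> C > 0 \<and>
      (\<forall>n\<ge>1. c \<le> real (growth G S n) / real n powr d \<and>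
             real (growth G S n) / real n powr d \<le> C))"

text \<open>\<open>W n\<close> is the set of vertices protected at time \<open>n\<close>, for \<open>n \<ge> 1\<close>; the value \<open>W 0\<close> is
  never used.\<close>

primrec fire :: "('a, 'b) monoid_scheme \<Rightarrow> 'a set \<Rightarrow> 'a set \<Rightarrow> (nat \<Rightarrow> 'a set) \<Rightarrow> nat \<Rightarrow> 'a set" where
  "fire G S F0 W 0 = F0"
| "fire G S F0 W (Suc n) = fire G S F0 W n \<union>
     {x. (\<exists>y \<in> fire G S F0 W n. (y, x) \<in> cayley_edges G S) \<and> x \<notin> (\<Union>k\<in>{1..Suc n}. W k)}"

definition allowed_strategy ::
  "('a, 'b) monoid_scheme \<Rightarrow> 'a set \<Rightarrow> (nat \<Rightarrow> nat) \<Rightarrow> 'a set \<Rightarrow> (nat \<Rightarrow> 'a set) \<Rightarrow> bool" where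
  "allowed_strategy G S f F0 W \<longleftrightarrow>
    (\<forall>n\<ge>1. W n \<subseteq> carrier G \<and> finite (W n) \<and> card (W n) \<le> f n \<and>
           W n \<inter> fire G S F0 W (n - 1) = {})"

definition never_on_fire ::
  "('a, 'b) monoid_scheme \<Rightarrow> 'a set \<Rightarrow> 'a set \<Rightarrow> (nat \<Rightarrow> 'a set) \<Rightarrow> 'a set" where
  "never_on_fire G S F0 W = carrier G - (\<Union>n. fire G S F0 W n)"

text \<open>This is the form of the retaining property used for groups of polynomial growth.  By
  \<open>retaining_property_iff_growth_equiv\<close> below it agrees, for growth of order \<open>d > 0\<close>, with
  the one asking that \<open>\<lambda>n. card (never_on_fire G S F0 W \<inter> cayley_ball G S n)\<close> be
  equivalent to the growth function.  For finite groups (\<open>d = 0\<close>) the latter condition is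
  vacuous, because all bounded functions are equivalent.\<close>

definition retaining_property ::
  "('a, 'b) monoid_scheme \<Rightarrow> 'a set \<Rightarrow> (nat \<Rightarrow> nat) \<Rightarrow> bool" where
  "retaining_property G S f \<longleftrightarrow>
    (\<forall>F0. finite F0 \<and> F0 \<subseteq> carrier G \<longrightarrow>
      (\<exists>c>0. \<exists>W. allowed_strategy G S f F0 W \<and>
        (\<forall>\<^sub>F n in sequentially.
           real (card (never_on_fire G S F0 W \<inter> cayley_ball G S n)) \<ge> c * real (growth G S n))))"

text \<open>The constant can be taken to be a natural number, as the functions compared are monotone.\<close>

definition growth_le :: "(nat \<Rightarrow> nat) \<Rightarrow> (nat \<Rightarrow> nat) \<Rightarrow> bool" where
  "growth_le a b \<longleftrightarrow> (\<exists>C>0. \<forall>n. a n \<le> C * b (C * n) + C)"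

definition growth_equiv :: "(nat \<Rightarrow> nat) \<Rightarrow> (nat \<Rightarrow> nat) \<Rightarrow> bool" where
  "growth_equiv a b \<longleftrightarrow> growth_le a b \<and> growth_le b a"

lemma cayley_ball_mono: "m \<le> n \<Longrightarrow> cayley_ball G S m \<subseteq> cayley_ball G S n"
  by (auto simp: cayley_ball_def)

lemma polynomial_growth_finite_ball:
  assumes "polynomial_growth G S d"
  shows "finite (cayley_ball G S n)"
proof -
  obtain c where c: "c > 0" "\<And>n. n \<ge> 1 \<Longrightarrow> c \<le> real (growth G S n) / real n powr d"
    using assms by (auto simp: polynomial_growth_def)
  have "growth G S (Suc n) \<noteq> 0"
  proof
    assume "growth G S (Suc n) = 0"
    then show False using c(1) c(2)[of "Suc n"] by simp
  qed
  then have "finite (cayley_ball G S (Suc n))"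
    unfolding growth_def by (meson card.infinite)
  then show ?thesis
    using cayley_ball_mono[of n "Suc n" G S] finite_subset by auto
qed

lemma growth_equiv_iff_proportion:
  fixes a v :: "nat \<Rightarrow> nat" and d :: real
  assumes d: "d > 0" and cs: "c1 > 0" "C1 > 0"
    and lower: "\<And>n. n \<ge> 1 \<Longrightarrow> c1 * real n powr d \<le> real (v n)"
    and upper: "\<And>n. n \<ge> 1 \<Longrightarrow> real (v n) \<le> C1 * real n powr d"
    and a: "mono a" and v: "mono v" and av: "\<And>n. a n \<le> v n"
  shows "growth_equiv a v \<longleftrightarrow> (\<exists>c>0. \<forall>\<^sub>F n in sequentially. real (a n) \<ge> c * real (v n))"
proof
  assume "growth_equiv a v"
  then obtain C where C: "C > 0" "\<And>n. v n \<le> C * a (C * n) + C"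
    by (auto simp: growth_equiv_def growth_le_def)
  define c where "c = c1 / (2 * C) powr d / C1 / (2 * C)"
  obtain N :: nat where N0: "real N \<ge> (2 * C / c1) powr (1 / d)"
    using real_arch_simple by blast
  have N: "c1 * real n powr d \<ge> 2 * C" if "n \<ge> N" for n
  proof -
    have "2 * C / c1 = ((2 * C / c1) powr (1 / d)) powr d"
      using d cs by (simp add: powr_powr)
    also have "\<dots> \<le> real n powr d"
      using d N0 that by (intro powr_mono2) auto
    finally show ?thesis using cs by (simp add: field_simps)
  qed
  have "real (a m) \<ge> c * real (v m)" if m: "m \<ge> C * (N + 1)" for m
  proof -
    define n where "n = m div C"
    have n: "n \<ge> N + 1"
      unfolding n_def using m C(1) by (simp add: less_eq_div_iff_mult_less_eq mult.commute)
    have "m = C * n + m mod C" by (simp add: n_def)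
    moreover have "m mod C < C" using C(1) by simp
    moreover have "C \<le> C * n" using n by simp
    ultimately have m2: "m \<le> 2 * C * n" and Cn: "C * n \<le> m" by linarith+
    have big: "real (v n) \<ge> 2 * C"
      using N[of n] lower[of n] n by simp
    have "real (v n) \<le> C * real (a (C * n)) + C"
      using C(2)[of n] by (metis of_nat_add of_nat_le_iff of_nat_mult)
    also have "real (a (C * n)) \<le> real (a m)"
      using a Cn by (simp add: monoD)
    finally have "real (v n) \<le> C * real (a m) + C"
      using C(1) by simp
    then have 1: "real (v n) / (2 * C) \<le> real (a m)"
      using big C(1) by (simp add: field_simps)
    have "real m powr d \<le> (2 * C * real n) powr d"
    proof (intro powr_mono2)
      show "real m \<le> 2 * C * real n"
        using m2 by (metis of_nat_le_iff of_nat_mult of_nat_numeral)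
    qed (use d in auto)
    also have "\<dots> = (2 * C) powr d * real n powr d"
      by (simp add: powr_mult)
    finally have "real m powr d / (2 * C) powr d \<le> real n powr d"
      using C(1) by (simp add: field_simps)
    moreover have "real (v m) / C1 \<le> real m powr d"
    proof -
      have "m \<ge> 1" using n Cn C(1) by (metis One_nat_def add_leE le_trans less_eq_Suc_le mult_le_mono nat_mult_1)
      then show ?thesis using upper[of m] cs by (simp add: field_simps)
    qed
    ultimately have "real (v m) / C1 / (2 * C) powr d \<le> real n powr d"
      using C(1) by (meson divide_right_mono dual_order.trans powr_ge_zero)
    then have "c1 * (real (v m) / C1 / (2 * C) powr d) \<le> c1 * real n powr d"
      using cs by (intro mult_left_mono) auto
    also have "\<dots> \<le> real (v n)" using lower[of n] n by simp
    finally have "c1 * (real (v m) / C1 / (2 * C) powr d) / (2 * C) \<le> real (v n) / (2 * C)"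
      using C(1) by (intro divide_right_mono) auto
    moreover have "c1 * (real (v m) / C1 / (2 * C) powr d) / (2 * C) = c * real (v m)"
      by (simp add: c_def)
    ultimately show ?thesis using 1 by linarith
  qed
  then have "\<forall>\<^sub>F n in sequentially. real (a n) \<ge> c * real (v n)"
    by (auto simp: eventually_sequentially)
  moreover have "c > 0" using cs C(1) by (simp add: c_def)
  ultimately show "\<exists>c>0. \<forall>\<^sub>F n in sequentially. real (a n) \<ge> c * real (v n)" by blast
next
  assume "\<exists>c>0. \<forall>\<^sub>F n in sequentially. real (a n) \<ge> c * real (v n)"
  then obtain c N where c: "c > 0" "\<And>n. n \<ge> N \<Longrightarrow> real (a n) \<ge> c * real (v n)"
    by (auto simp: eventually_sequentially)
  define C where "C = nat \<lceil>1 / c\<rceil> + v N + 1"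
  have C: "real C \<ge> 1 / c" "C \<ge> v N" "C \<ge> 1"
    unfolding C_def using real_nat_ceiling_ge[of "1 / c"] by auto
  have "v n \<le> C * a (C * n) + C" for n
  proof (cases "n \<ge> N")
    case True
    have "real (v n) \<le> 1 / c * real (a n)"
      using c(2)[OF True] c(1) by (simp add: field_simps)
    also have "\<dots> \<le> real C * real (a (C * n))"
      using C a by (intro mult_mono) (auto simp: monoD)
    finally have "v n \<le> C * a (C * n)"
      by (metis of_nat_le_iff of_nat_mult)
    then show ?thesis by simp
  next
    case False
    then have "v n \<le> v N" using v by (simp add: monoD)
    then show ?thesis using C(2) by simp
  qed
  then have "growth_le v a"
    unfolding growth_le_def using C(3) by (intro exI[of _ C]) auto
  moreover have "growth_le a v"
    unfolding growth_le_def using av by (intro exI[of _ 1]) (auto intro: le_SucI)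
  ultimately show "growth_equiv a v" by (simp add: growth_equiv_def)
qed

lemma retaining_property_iff_growth_equiv:
  assumes pg: "polynomial_growth G S d" and d: "d > 0"
  shows "retaining_property G S f \<longleftrightarrow>
    (\<forall>F0. finite F0 \<and> F0 \<subseteq> carrier G \<longrightarrow>
      (\<exists>W. allowed_strategy G S f F0 W \<and>
        growth_equiv (\<lambda>n. card (never_on_fire G S F0 W \<inter> cayley_ball G S n)) (growth G S)))"
proof -
  obtain c1 C1 where *: "c1 > 0" "C1 > 0"
    "\<And>n. n \<ge> 1 \<Longrightarrow> c1 \<le> real (growth G S n) / real n powr d"
    "\<And>n. n \<ge> 1 \<Longrightarrow> real (growth G S n) / real n powr d \<le> C1"
    using pg by (auto simp: polynomial_growth_def)
  have fin: "finite (cayley_ball G S n)" for n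
    by (rule polynomial_growth_finite_ball[OF pg])
  have "growth_equiv (\<lambda>n. card (U \<inter> cayley_ball G S n)) (growth G S) \<longleftrightarrow>
    (\<exists>c>0. \<forall>\<^sub>F n in sequentially. real (card (U \<inter> cayley_ball G S n)) \<ge> c * real (growth G S n))"
    for U
  proof (rule growth_equiv_iff_proportion[OF d *(1,2)])
    show "c1 * real n powr d \<le> real (growth G S n)" if "n \<ge> 1" for n
      using *(3)[OF that] that by (simp add: field_simps)
    show "real (growth G S n) \<le> C1 * real n powr d" if "n \<ge> 1" for n
      using *(4)[OF that] that by (simp add: field_simps)
    show "mono (\<lambda>n. card (U \<inter> cayley_ball G S n))"
      using cayley_ball_mono[of _ _ G S] fin by (intro monoI card_mono) blast+
    show "mono (growth G S)"
      unfolding growth_def using cayley_ball_mono[of _ _ G S] fin by (intro monoI card_mono) blast+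
    show "card (U \<inter> cayley_ball G S n) \<le> growth G S n" for n
      unfolding growth_def using fin by (intro card_mono) auto
  qed
  then show ?thesis
    unfolding retaining_property_def by (simp only:) blast
qed

end

theory Submission imports Defs "HOL-Real_Asymp.Real_Asymp" begin

text \<open>
  When \<open>d > 1\<close>, the total number of vertices protected up to time \<open>n\<close> is \<open>o(n^(d-1))\<close>
  (\<open>total_protection_small\<close>), whereas the boundary of a fire of size comparable to \<open>n^d\<close> has
  at least the order of \<open>n^(d-1)\<close>.  So protection loses against isoperimetry, and this is used twice.

  First, the isoperimetric inequality \<open>isoperimetry\<close> and the lower bound on the growth give
  \<open>|boundary F| \<ge> const * |F|^((d-1)/d)\<close>.  Hence a fire that starts on a
  large enough ball, of a radius depending only on \<open>f\<close> and the graph, satisfies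
  \<open>|F_n| \<ge> c n^d\<close> at all times, whatever the strategy (\<open>fire_spreads_linearly\<close>).

  Secondly, suppose that a strategy keeps a positive proportion of every large ball out of the
  fire forever.  For large \<open>n\<close>, from time \<open>n\<close> on, both the fire and its complement fill a positive
  proportion of the ball of radius \<open>2n\<close>.  The relative inequality
  \<open>relative_isoperimetry\<close> then produces at least \<open>\<kappa> n^(d-1)\<close> boundary vertices in the ball
  of radius \<open>6n\<close> at each such time.  By the end of \<open>K n\<close> further steps, \<open>K\<close> constant, only
  \<open>o(n^(d-1))\<close> vertices have been protected in total, so each step burns at least \<open>\<kappa>/2 n^(d-1)\<close> new vertices of
  that ball.  For \<open>K\<close> large this exceeds its size, which is \<open>O(n^d)\<close> (\<open>not_retaining\<close>).

  The saved proportion may depend on the initial fire, so the radius of the initial ball has to be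
  fixed before that proportion is known.

  Both isoperimetric inequalities come from one count of paths, \<open>crossing_count\<close>.  If \<open>d < 1\<close>,
  the group is finite, because the growth of an infinite group is at least linear, and a fire on the
  whole group leaves nothing to save.  At \<open>d = 1\<close> the argument breaks down: boundaries may
  have bounded size there, and protecting finitely many vertices can stop a fire for good.
\<close>

section \<open>Balls and walks in a Cayley graph\<close>

definition outer_boundary :: "('a, 'b) monoid_scheme \<Rightarrow> 'a set \<Rightarrow> 'a set \<Rightarrow> 'a set" where
  "outer_boundary G S F = {x. x \<notin> F \<and> (\<exists>y\<in>F. (y, x) \<in> cayley_edges G S)}"

locale cayley_graph = group G for G (structure) +
  fixes S :: "'a set"
  assumes finite_S: "finite S"
    and S_carrier: "S \<subseteq> carrier G"
    and S_inv: "s \<in> S \<Longrightarrow> inv s \<in> S"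
    and S_generates: "generate G S = carrier G"
begin

abbreviation "E \<equiv> cayley_edges G S"
abbreviation "ball \<equiv> cayley_ball G S"
abbreviation "boundary \<equiv> outer_boundary G S"

lemma edge_carrier: "(x, y) \<in> E \<Longrightarrow> x \<in> carrier G \<and> y \<in> carrier G"
  using S_carrier by (auto simp: cayley_edges_def)

lemma edge_sym:
  assumes "(x, y) \<in> E" shows "(y, x) \<in> E"
proof -
  obtain s where s: "x \<in> carrier G" "s \<in> S" "y = x \<otimes> s"
    using assms by (auto simp: cayley_edges_def)
  then have "s \<in> carrier G" using S_carrier by auto
  with s have "y \<in> carrier G" "inv s \<in> S" "x = y \<otimes> inv s"
    by (auto simp: S_inv m_assoc)
  then show ?thesis by (auto simp: cayley_edges_def)
qed

lemma edge_translate: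
  assumes "g \<in> carrier G" "(x, y) \<in> E" shows "(g \<otimes> x, g \<otimes> y) \<in> E"
proof -
  obtain s where s: "x \<in> carrier G" "s \<in> S" "y = x \<otimes> s"
    using assms by (auto simp: cayley_edges_def)
  then have "s \<in> carrier G" using S_carrier by auto
  with s assms(1) have "g \<otimes> x \<in> carrier G" "g \<otimes> y = (g \<otimes> x) \<otimes> s"
    by (auto simp: m_assoc)
  with s(2) show ?thesis by (auto simp: cayley_edges_def)
qed

lemma walk_carrier: "(x, y) \<in> E ^^ k \<Longrightarrow> x \<in> carrier G \<Longrightarrow> y \<in> carrier G"
  by (induction k arbitrary: y) (auto dest: edge_carrier)

lemma walk_translate:
  "g \<in> carrier G \<Longrightarrow> (x, y) \<in> E ^^ k \<Longrightarrow> (g \<otimes> x, g \<otimes> y) \<in> E ^^ k"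
  by (induction k arbitrary: y) (auto intro: edge_translate)

lemma walk_sym: "(x, y) \<in> E ^^ k \<Longrightarrow> (y, x) \<in> E ^^ k"
proof (induction k arbitrary: y)
  case (Suc k)
  then obtain z where z: "(x, z) \<in> E ^^ k" "(z, y) \<in> E" by auto
  then show ?case using Suc.IH edge_sym relpow_Suc_I2 by metis
qed simp

lemma walk_mult:
  assumes "(\<one>, x) \<in> E ^^ i" "(\<one>, y) \<in> E ^^ j"
  shows "(\<one>, x \<otimes> y) \<in> E ^^ (i + j)"
proof -
  have x: "x \<in> carrier G" using walk_carrier[OF assms(1)] by simp
  have "(x, x \<otimes> y) \<in> E ^^ j" using walk_translate[OF x assms(2)] x by simp
  with assms(1) show ?thesis by (auto simp: relpow_add)
qed

lemma edge_one: "s \<in> S \<Longrightarrow> (\<one>, s) \<in> E"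
  using S_carrier by (force simp: cayley_edges_def)

lemma reachable:
  assumes "x \<in> carrier G" shows "\<exists>k. (\<one>, x) \<in> E ^^ k"
proof -
  have "x \<in> generate G S" using assms S_generates by simp
  then show ?thesis
  proof induction
    case one
    show ?case by (rule exI[of _ 0]) simp
  next
    case (incl h)
    then show ?case using edge_one by (intro exI[of _ 1]) simp
  next
    case (inv h)
    then show ?case using edge_one S_inv by (intro exI[of _ 1]) simp
  next
    case (eng h1 h2)
    then show ?case using walk_mult by blast
  qed
qed

text \<open>Since every vertex is reachable, membership in a ball amounts to the existence of a short
  walk, and no further reasoning about minimal lengths is necessary.\<close>

lemma mem_ball_iff: "x \<in> ball n \<longleftrightarrow> (\<exists>k\<le>n. (\<one>, x) \<in> E ^^ k)"
proof
  assume x: "x \<in> ball n"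
  then have "(\<one>, x) \<in> E ^^ cayley_dist G S \<one> x"
    using LeastI_ex[OF reachable[of x]] by (simp add: cayley_dist_def cayley_ball_def)
  with x show "\<exists>k\<le>n. (\<one>, x) \<in> E ^^ k" by (auto simp: cayley_ball_def)
next
  assume "\<exists>k\<le>n. (\<one>, x) \<in> E ^^ k"
  then obtain k where k: "k \<le> n" "(\<one>, x) \<in> E ^^ k" by blast
  then have "cayley_dist G S \<one> x \<le> k" unfolding cayley_dist_def by (intro Least_le)
  with k walk_carrier[OF k(2)] show "x \<in> ball n" by (simp add: cayley_ball_def)
qed

lemma ball_carrier: "ball n \<subseteq> carrier G"
  by (auto simp: cayley_ball_def)

lemma one_in_ball: "\<one> \<in> ball n"
  unfolding mem_ball_iff by (rule exI[of _ 0]) simp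

lemma ball_mult:
  assumes "x \<in> ball m" "y \<in> ball n" shows "x \<otimes> y \<in> ball (m + n)"
  using assms walk_mult unfolding mem_ball_iff by (meson add_mono)

lemma ball_inv:
  assumes "x \<in> ball n" shows "inv x \<in> ball n"
proof -
  obtain k where k: "k \<le> n" "(\<one>, x) \<in> E ^^ k" using assms by (auto simp: mem_ball_iff)
  have x: "x \<in> carrier G" using assms ball_carrier by auto
  have "(inv x \<otimes> x, inv x \<otimes> \<one>) \<in> E ^^ k"
    by (rule walk_translate[OF inv_closed[OF x] walk_sym[OF k(2)]])
  then show ?thesis using k x by (auto simp: mem_ball_iff)
qed

lemma edge_ball:
  assumes "x \<in> ball n" "(x, y) \<in> E" shows "y \<in> ball (Suc n)"
  using assms unfolding mem_ball_iff by (meson Suc_le_mono relpow_Suc_I)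

lemma ball_Suc: "ball (Suc n) \<subseteq> ball n \<union> boundary (ball n)"
proof
  fix x assume "x \<in> ball (Suc n)"
  then obtain k where k: "k \<le> Suc n" "(\<one>, x) \<in> E ^^ k" by (auto simp: mem_ball_iff)
  show "x \<in> ball n \<union> boundary (ball n)"
  proof (cases k)
    case 0
    then show ?thesis using k one_in_ball by auto
  next
    case (Suc j)
    then obtain z where z: "(\<one>, z) \<in> E ^^ j" "(z, x) \<in> E" using k by auto
    have "z \<in> ball n" using z(1) Suc k(1) by (auto simp: mem_ball_iff)
    with z(2) show ?thesis by (auto simp: outer_boundary_def)
  qed
qed

lemma finite_boundary: "finite F \<Longrightarrow> finite (boundary F)"
proof -
  assume "finite F"
  then have "finite ((\<lambda>(x, s). x \<otimes> s) ` (F \<times> S))" using finite_S by simp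
  moreover have "boundary F \<subseteq> (\<lambda>(x, s). x \<otimes> s) ` (F \<times> S)"
    by (auto simp: outer_boundary_def cayley_edges_def)
  ultimately show ?thesis using finite_subset by blast
qed

lemma finite_ball: "finite (ball n)"
proof (induction n)
  case 0
  have "ball 0 \<subseteq> {\<one>}" by (auto simp: mem_ball_iff)
  then show ?case using finite_subset by blast
next
  case (Suc n)
  then show ?case using ball_Suc finite_boundary finite_subset by (metis finite_Un)
qed

lemma card_ball_pos: "card (ball n) > 0"
  using finite_ball one_in_ball card_gt_0_iff by blast

text \<open>A ball equal to the next one is closed under taking neighbours, hence is the whole group;
  so in an infinite group every increment of the radius adds a vertex.\<close>

lemma growth_ge_of_infinite:
  assumes "infinite (carrier G)" shows "growth G S n \<ge> n"
proof (induction n)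
  case (Suc n)
  have "\<not> ball (Suc n) \<subseteq> ball n"
  proof
    assume sub: "ball (Suc n) \<subseteq> ball n"
    have "x \<in> ball n" if "(\<one>, x) \<in> E ^^ k" for x k
      using that
    proof (induction k arbitrary: x)
      case (Suc k)
      then show ?case using edge_ball sub by (meson relpow_Suc_E subsetD)
    qed (simp add: one_in_ball)
    then have "carrier G \<subseteq> ball n" using reachable by blast
    with assms finite_ball finite_subset show False by blast
  qed
  then have "ball n \<subset> ball (Suc n)" using cayley_ball_mono[of n "Suc n" G S] by auto
  then have "growth G S n < growth G S (Suc n)"
    unfolding growth_def using finite_ball by (intro psubset_card_mono)
  with Suc show ?case by simp
qed simp

section \<open>Isoperimetry by counting paths\<close>

text \<open>A pair \<open>(x, z)\<close> in \<open>P\<close> encodes a jump from \<open>x\<close> inside \<open>F\<close> to \<open>x \<otimes> z\<close> outside.  Fix, for every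
  \<open>z\<close>, one path from \<open>\<one>\<close> to \<open>z\<close> of length at most \<open>r\<close>; its translate by \<open>x\<close> leaves \<open>F\<close> at some
  step, at a boundary vertex.  That vertex, the step and \<open>z\<close> determine \<open>x\<close>, because
  the path depends on \<open>z\<close> only.  The set \<open>Q\<close> confines the boundary
  vertices to a region that the translated paths do not leave.\<close>

lemma crossing_count:
  assumes F: "F \<subseteq> carrier G" and Q: "finite (boundary F \<inter> Q)"
    and P: "\<And>x z. (x, z) \<in> P \<Longrightarrow> x \<in> F \<and> z \<in> ball r \<and> x \<otimes> z \<notin> F"
    and PQ: "\<And>x z y. (x, z) \<in> P \<Longrightarrow> y \<in> ball r \<Longrightarrow> x \<otimes> y \<in> Q"
  shows "card P \<le> r * card (ball r) * card (boundary F \<inter> Q)"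
proof -
  have "\<exists>p. p 0 = \<one> \<and> (\<exists>k\<le>r. p k = z \<and> (\<forall>i<k. (p i, p (Suc i)) \<in> E))"
    if "z \<in> ball r" for z
    using that unfolding mem_ball_iff relpow_fun_conv by blast
  then obtain p where p: "\<And>z. z \<in> ball r \<Longrightarrow> p z 0 = \<one> \<and>
      (\<exists>k\<le>r. p z k = z \<and> (\<forall>i<k. (p z i, p z (Suc i)) \<in> E))"
    by metis
  have "\<exists>i<r. x \<otimes> p z (Suc i) \<in> boundary F \<inter> Q \<and> p z (Suc i) \<in> carrier G"
    if xz: "(x, z) \<in> P" for x z
  proof -
    have x: "x \<in> F" "z \<in> ball r" "x \<otimes> z \<notin> F" using P[OF xz] by auto
    then have xc: "x \<in> carrier G" using F by auto
    obtain k where k: "k \<le> r" "p z k = z" "\<And>i. i < k \<Longrightarrow> (p z i, p z (Suc i)) \<in> E"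
      and p0: "p z 0 = \<one>" using p[OF x(2)] by auto
    have walk: "(\<one>, p z i) \<in> E ^^ i" if "i \<le> k" for i
      using that by (induction i) (use p0 k(3) in auto)
    \<comment> \<open>Step \<open>j\<close> is the first exit from \<open>F\<close>, so its predecessor \<open>i\<close> is still inside.\<close>
    define j where "j = (LEAST i. x \<otimes> p z i \<notin> F)"
    have j: "x \<otimes> p z j \<notin> F" unfolding j_def by (rule LeastI[of _ k]) (use k x in simp)
    have jk: "j \<le> k" unfolding j_def by (rule Least_le) (use k x in simp)
    have "j \<noteq> 0" using j p0 x xc by (cases j) auto
    then obtain i where i: "j = Suc i" by (cases j) auto
    have "x \<otimes> p z i \<in> F" using not_less_Least[of i "\<lambda>i. x \<otimes> p z i \<notin> F"] i j_def by auto
    moreover have "(x \<otimes> p z i, x \<otimes> p z (Suc i)) \<in> E"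
      using edge_translate[OF xc] k(3) jk i by auto
    ultimately have "x \<otimes> p z (Suc i) \<in> boundary F"
      using j i by (auto simp: outer_boundary_def)
    moreover have "p z (Suc i) \<in> ball r"
      using walk[OF jk] jk k(1) i unfolding mem_ball_iff by (meson order_trans)
    ultimately show ?thesis using PQ[OF xz] ball_carrier jk k(1) i by (intro exI[of _ i]) auto
  qed
  then obtain h where h: "\<And>x z. (x, z) \<in> P \<Longrightarrow> h x z < r \<and>
      x \<otimes> p z (Suc (h x z)) \<in> boundary F \<inter> Q \<and> p z (Suc (h x z)) \<in> carrier G"
    by metis
  define \<Phi> where "\<Phi> = (\<lambda>(x, z). (x \<otimes> p z (Suc (h x z)), z, h x z))"
  have "inj_on \<Phi> P"
  proof (rule inj_onI)
    fix a b assume ab: "a \<in> P" "b \<in> P" "\<Phi> a = \<Phi> b"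
    obtain x z x' z' where [simp]: "a = (x, z)" "b = (x', z')" by (cases a, cases b)
    have eq: "z' = z" "x \<otimes> p z (Suc (h x z)) = x' \<otimes> p z (Suc (h x z))"
      using ab(3) by (auto simp: \<Phi>_def)
    have "x \<in> carrier G" "x' \<in> carrier G" "p z (Suc (h x z)) \<in> carrier G"
      using ab P h F by auto
    with eq have "x = x'" by simp
    with eq show "a = b" by simp
  qed
  then have "card P = card (\<Phi> ` P)" by (simp add: card_image)
  also have "\<dots> \<le> card ((boundary F \<inter> Q) \<times> ball r \<times> {..<r})"
  proof (rule card_mono)
    show "finite ((boundary F \<inter> Q) \<times> ball r \<times> {..<r})" using Q finite_ball by simp
    show "\<Phi> ` P \<subseteq> (boundary F \<inter> Q) \<times> ball r \<times> {..<r}"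
      using h P unfolding \<Phi>_def by fastforce
  qed
  also have "\<dots> = r * card (ball r) * card (boundary F \<inter> Q)"
    by (simp add: card_cartesian_product)
  finally show ?thesis .
qed

text \<open>When a ball has at least twice the size of \<open>A\<close>, at least half of the jumps from a given point
  of \<open>A\<close> by elements of the ball leave \<open>A\<close>.\<close>

lemma isoperimetry:
  assumes A: "finite A" "A \<subseteq> carrier G" and r: "2 * card A \<le> card (ball r)"
  shows "card A \<le> 2 * r * card (boundary A)"
proof -
  define P where "P = Sigma A (\<lambda>x. {z \<in> ball r. x \<otimes> z \<notin> A})"
  have half: "card (ball r) \<le> 2 * card {z \<in> ball r. x \<otimes> z \<notin> A}" if "x \<in> A" for x
  proof -
    have x: "x \<in> carrier G" using A that by auto
    have "card {z \<in> ball r. x \<otimes> z \<in> A} \<le> card A"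
    proof (rule card_inj_on_le[of "\<lambda>z. x \<otimes> z"])
      show "inj_on (\<lambda>z. x \<otimes> z) {z \<in> ball r. x \<otimes> z \<in> A}"
        using x ball_carrier[of r] by (intro inj_onI) (auto simp: subset_iff)
    qed (use A in auto)
    moreover have "card (ball r) = card {z \<in> ball r. x \<otimes> z \<in> A} + card {z \<in> ball r. x \<otimes> z \<notin> A}"
      using finite_ball by (subst card_Un_disjoint[symmetric]) (auto intro!: arg_cong[where f = card])
    ultimately show ?thesis using r by simp
  qed
  have "card A * card (ball r) \<le> (\<Sum>x\<in>A. 2 * card {z \<in> ball r. x \<otimes> z \<notin> A})"
    using sum_mono[of A "\<lambda>_. card (ball r)"] half by simp
  also have "\<dots> = 2 * card P"
    unfolding P_def using A finite_ball by (subst card_SigmaI) (auto simp: sum_distrib_left)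
  also have "card P \<le> r * card (ball r) * card (boundary A \<inter> UNIV)"
    by (rule crossing_count) (use A finite_boundary in \<open>auto simp: P_def\<close>)
  finally have "card A * card (ball r) \<le> (2 * r * card (boundary A)) * card (ball r)"
    by (simp add: mult_ac)
  then show ?thesis using card_ball_pos[of r] by simp
qed

text \<open>Two points of the ball of radius \<open>N\<close> differ by an element of the ball of radius \<open>2 * N\<close>,
  and short paths between them stay in the ball of radius \<open>3 * N\<close>.  The jumps counted are all
  pairs of a point of the ball in \<open>F\<close> and a point of the ball outside \<open>F\<close>.\<close>

lemma relative_isoperimetry:
  assumes F: "F \<subseteq> carrier G"
  shows "card (F \<inter> ball N) * card (ball N - F)
    \<le> 2 * N * card (ball (2 * N)) * card (boundary F \<inter> ball (3 * N))"
proof -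
  define \<phi> where "\<phi> = (\<lambda>(x, y). (x, inv x \<otimes> y))"
  define X where "X = (F \<inter> ball N) \<times> (ball N - F)"
  have b: "x \<in> carrier G" if "x \<in> ball N" for x using that ball_carrier by auto
  have "inj_on \<phi> X"
    by (rule inj_onI) (auto simp: \<phi>_def X_def b)
  then have "card (F \<inter> ball N) * card (ball N - F) = card (\<phi> ` X)"
    by (simp add: card_image X_def card_cartesian_product)
  also have "\<dots> \<le> 2 * N * card (ball (2 * N)) * card (boundary F \<inter> ball (3 * N))"
  proof (rule crossing_count[OF F])
    show "finite (boundary F \<inter> ball (3 * N))" using finite_ball by blast
  next
    fix x z assume "(x, z) \<in> \<phi> ` X"
    then obtain y where y: "x \<in> F" "x \<in> ball N" "y \<in> ball N" "y \<notin> F" "z = inv x \<otimes> y"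
      by (auto simp: \<phi>_def X_def)
    have "z \<in> ball (2 * N)" using ball_mult[OF ball_inv[OF y(2)] y(3)] y(5) by (simp add: mult_2)
    moreover have "x \<otimes> z = y" using y b by (simp add: m_assoc[symmetric])
    ultimately show "x \<in> F \<and> z \<in> ball (2 * N) \<and> x \<otimes> z \<notin> F" using y by simp
  next
    fix x z y assume "(x, z) \<in> \<phi> ` X" "y \<in> ball (2 * N)"
    then have "x \<otimes> y \<in> ball (N + 2 * N)" by (intro ball_mult) (auto simp: \<phi>_def X_def)
    then show "x \<otimes> y \<in> ball (3 * N)" by simp
  qed
  finally show ?thesis .
qed

section \<open>One step of the fire\<close>

lemma fire_carrier: "F0 \<subseteq> carrier G \<Longrightarrow> fire G S F0 W n \<subseteq> carrier G"
  by (induction n) (auto dest: edge_carrier)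

lemma fire_mono: "m \<le> n \<Longrightarrow> fire G S F0 W m \<subseteq> fire G S F0 W n"
  by (rule lift_Suc_mono_le) auto

lemma fire_subset_ball: "fire G S (ball R) W n \<subseteq> ball (n + R)"
proof (induction n)
  case (Suc n)
  then show ?case using edge_ball cayley_ball_mono[of "n + R" "Suc n + R" G S] by auto
qed simp

text \<open>Only protection can stop a boundary vertex from catching fire, so the fire gains at least
  the difference between its boundary and everything protected so far.  The set \<open>Q\<close> localises
  the count to a region.\<close>

lemma fire_step:
  assumes W: "allowed_strategy G S f F0 W" and fin: "finite (fire G S F0 W n)"
  shows "card (fire G S F0 W n \<inter> Q) + card (boundary (fire G S F0 W n) \<inter> Q)
    \<le> card (fire G S F0 W (Suc n) \<inter> Q) + (\<Sum>k=1..Suc n. f k)"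
proof -
  let ?F = "fire G S F0 W n" and ?V = "\<Union>k\<in>{1..Suc n}. W k"
  have V: "finite ?V" using W by (auto simp: allowed_strategy_def)
  have "card ?V \<le> (\<Sum>k=1..Suc n. card (W k))" by (intro card_UN_le) auto
  also have "\<dots> \<le> (\<Sum>k=1..Suc n. f k)"
    using W by (intro sum_mono) (auto simp: allowed_strategy_def)
  finally have cV: "card ?V \<le> (\<Sum>k=1..Suc n. f k)" .
  have "fire G S F0 W (Suc n) \<subseteq> ?F \<union> boundary ?F"
    by (auto simp: outer_boundary_def)
  then have fin': "finite (fire G S F0 W (Suc n))"
    using fin finite_boundary finite_subset by blast
  have "card (?F \<inter> Q) + card (boundary ?F \<inter> Q) = card ((?F \<inter> Q) \<union> (boundary ?F \<inter> Q))"
    using fin finite_boundary by (intro card_Un_disjoint[symmetric]) (auto simp: outer_boundary_def)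
  also have "\<dots> \<le> card ((fire G S F0 W (Suc n) \<inter> Q) \<union> ?V)"
    using fin' V by (intro card_mono) (auto simp: outer_boundary_def)
  also have "\<dots> \<le> card (fire G S F0 W (Suc n) \<inter> Q) + card ?V" by (rule card_Un_le)
  finally show ?thesis using cV by linarith
qed

end

section \<open>Sparse protection\<close>

lemma powr_diff_le:
  fixes x d :: real
  assumes "x \<ge> 1" "d \<ge> 1"
  shows "(x + 1) powr d \<le> x powr d + d * 2 powr d * x powr (d - 1)"
proof -
  have "\<exists>z. x < z \<and> z < x + 1 \<and> (x + 1) powr d - x powr d = (x + 1 - x) * (d * z powr (d - 1))"
    using assms by (intro MVT2) (auto intro!: derivative_eq_intros simp: powr_diff)
  then obtain z where z: "x < z" "z < x + 1" "(x + 1) powr d - x powr d = d * z powr (d - 1)"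
    by auto
  have "z powr (d - 1) \<le> (2 * x) powr (d - 1)"
    using z assms by (intro powr_mono2) auto
  also have "\<dots> = 2 powr (d - 1) * x powr (d - 1)" using assms by (simp add: powr_mult)
  also have "\<dots> \<le> 2 powr d * x powr (d - 1)" by (intro mult_right_mono powr_mono) auto
  finally have "d * z powr (d - 1) \<le> d * (2 powr d * x powr (d - 1))"
    using assms by (intro mult_left_mono) auto
  with z show ?thesis by (simp add: mult_ac)
qed

text \<open>If \<open>d \<ge> 2\<close>, the largest bound on the summands is the last one.  If \<open>d < 2\<close>, the bounds tend
  to \<open>0\<close>, so the integers \<open>f k\<close> eventually vanish.  In both cases \<open>f k \<le> e * n powr (d - 2)\<close> for all
  large \<open>k \<le> n\<close>, and the finitely many earlier terms are absorbed because \<open>d > 1\<close>.\<close>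

lemma total_protection_small:
  fixes f :: "nat \<Rightarrow> nat" and d \<epsilon> :: real
  assumes f: "(\<lambda>n. real (f n)) \<in> o(\<lambda>n. real n powr (d - 2))" and d: "d > 1" and \<epsilon>: "\<epsilon> > 0"
  shows "\<forall>\<^sub>F n in sequentially. real (\<Sum>k=1..n. f k) \<le> \<epsilon> * real n powr (d - 1)"
proof -
  \<comment> \<open>The bound \<open>1 / 2\<close> forces \<open>f k < 1\<close> in the case \<open>d < 2\<close>.\<close>
  define e where "e = min (\<epsilon> / 2) (1 / 2)"
  have e: "e > 0" "e \<le> \<epsilon> / 2" "e < 1" using \<epsilon> by (auto simp: e_def)
  obtain k0 where k0: "\<And>k. k \<ge> k0 \<Longrightarrow> real (f k) \<le> e * real k powr (d - 2)"
    using landau_o.smallD[OF f e(1)] by (auto simp: eventually_sequentially)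
  define m where "m = max k0 1"
  have late: "real (f k) \<le> e * real n powr (d - 2)" if "k \<ge> m" "k \<le> n" for k n
  proof (cases "d \<ge> 2")
    case True
    have "real k powr (d - 2) \<le> real n powr (d - 2)" using True that by (intro powr_mono2) auto
    then show ?thesis using k0[of k] that e by (smt (verit) m_def max.bounded_iff mult_left_mono)
  next
    case False
    have "real k powr (d - 2) \<le> real k powr 0" using False that by (intro powr_mono) (auto simp: m_def)
    moreover have "real k powr 0 = 1" using that by (auto simp: m_def)
    ultimately have "e * real k powr (d - 2) < 1" using e by (smt (verit) mult_left_le)
    with k0[of k] that have "f k = 0" by (auto simp: m_def)
    then show ?thesis using e by simp
  qed
  have bound: "real (\<Sum>k=1..n. f k) \<le> real (\<Sum>k=1..m. f k) + e * real n powr (d - 1)"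
    if n: "n \<ge> m" for n
  proof -
    have "{1..n} = {1..m} \<union> {Suc m..n}" using n by auto
    then have "real (\<Sum>k=1..n. f k) = real (\<Sum>k=1..m. f k) + (\<Sum>k\<in>{Suc m..n}. real (f k))"
      by (simp add: sum.union_disjoint)
    also have "(\<Sum>k\<in>{Suc m..n}. real (f k)) \<le> (\<Sum>k\<in>{Suc m..n}. e * real n powr (d - 2))"
      using late by (intro sum_mono) auto
    also have "\<dots> \<le> real n * (e * real n powr (d - 2))"
      using e by (simp add: mult_right_mono)
    also have "\<dots> = e * (real n powr 1 * real n powr (d - 2))" by simp
    also have "\<dots> = e * real n powr (d - 1)" by (simp only: powr_add[symmetric]) simp
    finally show ?thesis by simp
  qed
  have "filterlim (\<lambda>n. real n powr (d - 1)) at_top sequentially" using d by real_asymp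
  then have "\<forall>\<^sub>F n in sequentially. real n powr (d - 1) \<ge> real (\<Sum>k=1..m. f k) / e"
    by (simp add: filterlim_at_top)
  then show ?thesis using eventually_ge_at_top[of m]
  proof eventually_elim
    case (elim n)
    have "real (\<Sum>k=1..m. f k) \<le> e * real n powr (d - 1)"
      using elim e by (simp add: field_simps)
    then have "real (\<Sum>k=1..n. f k) \<le> 2 * e * real n powr (d - 1)" using bound[OF elim(2)] by simp
    also have "\<dots> \<le> \<epsilon> * real n powr (d - 1)" using e by (intro mult_right_mono) auto
    finally show ?case .
  qed
qed

section \<open>The spread of the fire when \<open>d > 1\<close>\<close>

locale polynomial_cayley_graph = cayley_graph +
  fixes d c1 C1 :: real
  assumes d: "d > 1" and c1: "c1 > 0" and C1: "C1 > 0"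
    and growth_lower: "n \<ge> 1 \<Longrightarrow> c1 * real n powr d \<le> real (card (ball n))"
    and growth_upper: "n \<ge> 1 \<Longrightarrow> real (card (ball n)) \<le> C1 * real n powr d"
begin

lemma finite_fire: "finite (fire G S (ball R) W n)"
  by (rule finite_subset[OF fire_subset_ball finite_ball])

text \<open>The induction compares \<open>|F_n|\<close> with \<open>c N^d\<close>, where \<open>N = n + R\<close>.  Unless the fire already has
  the size required at the next time, it is at most half of a ball of radius about \<open>N / M\<close>, and then
  its boundary is at least \<open>c M N^(d-1) / 4\<close>.  For \<open>M\<close> large, this pays both for the increment of
  \<open>c N^d\<close> and for all protected vertices, which number at most \<open>c N^(d-1)\<close> once \<open>R\<close> is large.
  The value of \<open>c\<close> is dictated by \<open>M\<close>, and \<open>R\<close> is chosen last.\<close>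

lemma fire_spreads_linearly:
  assumes f: "(\<lambda>n. real (f n)) \<in> o(\<lambda>n. real n powr (d - 2))"
  shows "\<exists>c>0. \<exists>R. \<forall>W n. allowed_strategy G S f (ball R) W \<longrightarrow>
    c * real (n + R) powr d \<le> real (card (fire G S (ball R) W n))"
proof -
  obtain M :: nat where M: "real M \<ge> 4 * (d * 2 powr d + 1)" using real_arch_simple by blast
  have "4 * (d * 2 powr d + 1) > 0" using d by (intro mult_pos_pos add_nonneg_pos) auto
  then have M0: "real M > 0" using M by linarith
  \<comment> \<open>Chosen so that \<open>c (N + 1)^d\<close> is at most half of the lower bound \<open>c1 (N / M)^d\<close> for a ball.\<close>
  define c where "c = c1 / (2 * 2 powr d * real M powr d)"
  have c: "c > 0" using c1 M0 by (simp add: c_def)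
  obtain m0 where m0: "\<And>n. n \<ge> m0 \<Longrightarrow> real (\<Sum>k=1..n. f k) \<le> c * real n powr (d - 1)"
    using total_protection_small[OF f d c] by (auto simp: eventually_sequentially)
  define R where "R = max m0 M"
  have R: "R \<ge> m0" "R \<ge> M" "R \<ge> 1" using M0 by (auto simp: R_def)
  have wall: "real (\<Sum>k=1..Suc n. f k) \<le> c * real (n + R) powr (d - 1)" for n
  proof -
    have "(\<Sum>k=1..Suc n. f k) \<le> (\<Sum>k=1..n + R. f k)" using R by (intro sum_mono2) auto
    then have "real (\<Sum>k=1..Suc n. f k) \<le> real (\<Sum>k=1..n + R. f k)" by (rule of_nat_mono)
    also have "\<dots> \<le> c * real (n + R) powr (d - 1)" using R by (intro m0) auto
    finally show ?thesis .
  qed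
  have "c * real (n + R) powr d \<le> real (card (fire G S (ball R) W n))"
    if W: "allowed_strategy G S f (ball R) W" for W n
  proof (induction n)
    case 0
    have "2 powr d \<ge> 2 powr 0" "real M powr d \<ge> real M powr 0"
      using d M0 by (intro powr_mono; simp)+
    then have "2 powr d * real M powr d \<ge> 1 * 1" using M0 by (intro mult_mono) auto
    then have "c1 * 1 \<le> c1 * (2 * (2 powr d * real M powr d))" using c1 by (intro mult_left_mono) auto
    then have "c \<le> c1" using M0 by (simp add: c_def field_simps)
    then have "c * real R powr d \<le> c1 * real R powr d" by (intro mult_right_mono) auto
    also have "\<dots> \<le> real (card (ball R))" using R by (intro growth_lower)
    finally show ?case by simp
  next
    case (Suc n)
    define N where "N = n + R"
    define a where "a = card (fire G S (ball R) W n)"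
    define a' where "a' = card (fire G S (ball R) W (Suc n))"
    define b where "b = card (boundary (fire G S (ball R) W n))"
    have N: "N \<ge> 1" "N \<ge> M" using R by (auto simp: N_def)
    have IH: "c * real N powr d \<le> real a" using Suc by (simp add: a_def N_def)
    have "a \<le> a'" unfolding a_def a'_def
      using finite_fire[of R W "Suc n"] fire_mono[of n "Suc n"] by (intro card_mono) auto
    have "c * real (N + 1) powr d \<le> real a'"
    proof (cases "c * real (N + 1) powr d \<le> real a")
      case True
      with \<open>a \<le> a'\<close> show ?thesis by linarith
    next
      case False
      define r where "r = N div M + 1"
      have rM: "real N \<le> real r * real M" "real r * real M \<le> 2 * real N"
      proof -
        have Npos: "M > 0" using M0 by simp
        have "N \<le> r * M" unfolding r_def
          using dividend_less_div_times[OF Npos, of N] by (simp add: algebra_simps)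
        then show "real N \<le> real r * real M" by (metis of_nat_le_iff of_nat_mult)
        have "r * M = N div M * M + M" by (simp add: r_def)
        moreover have "N div M * M \<le> N" by simp
        ultimately have "r * M \<le> 2 * N" using N(2) by linarith
        then show "real r * real M \<le> 2 * real N" by (metis of_nat_le_iff of_nat_mult of_nat_numeral)
      qed
      have "2 * real a \<le> 2 * (c * real (N + 1) powr d)" using False by simp
      also have "\<dots> \<le> 2 * (c * (2 * (real r * real M)) powr d)"
        using c d N rM by (intro mult_left_mono powr_mono2) auto
      also have "\<dots> = c1 * real r powr d"
        using M0 by (simp add: c_def powr_mult field_simps)
      also have "\<dots> \<le> real (card (ball r))" by (intro growth_lower) (simp add: r_def)
      finally have "2 * a \<le> card (ball r)" by linarith
      then have "a \<le> 2 * r * b"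
        unfolding a_def b_def using fire_carrier ball_carrier finite_fire by (intro isoperimetry) auto
      then have "real a \<le> 2 * real r * real b" by (metis of_nat_le_iff of_nat_mult of_nat_numeral)
      then have "real M * real a \<le> real M * (2 * real r * real b)" by (intro mult_left_mono) auto
      also have "\<dots> = 2 * (real r * real M) * real b" by simp
      also have "\<dots> \<le> 2 * (2 * real N) * real b" using rM by (intro mult_right_mono mult_left_mono) auto
      finally have 1: "real M * real a \<le> 4 * real N * real b" by simp
      have "real N * (4 * (d * 2 powr d + 1) * (c * real N powr (d - 1)))
          = 4 * (d * 2 powr d + 1) * (c * (real N * real N powr (d - 1)))" by simp
      also have "real N * real N powr (d - 1) = real N powr d"
        using N by (simp add: powr_diff)
      also have "4 * (d * 2 powr d + 1) * (c * real N powr d) \<le> real M * real a"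
        using M IH c d by (intro mult_mono) auto
      also note 1
      finally have "real N * (4 * (d * 2 powr d + 1) * (c * real N powr (d - 1)))
          \<le> real N * (4 * real b)" by simp
      then have "4 * (d * 2 powr d + 1) * (c * real N powr (d - 1)) \<le> 4 * real b"
        using N by simp
      then have b: "(d * 2 powr d + 1) * (c * real N powr (d - 1)) \<le> real b"
        by (simp add: algebra_simps)
      have "a + b \<le> a' + (\<Sum>k=1..Suc n. f k)"
        using fire_step[OF W finite_fire, of n UNIV] by (simp add: a_def b_def a'_def)
      then have "real a + real b \<le> real a' + real (\<Sum>k=1..Suc n. f k)"
        by (metis of_nat_add of_nat_le_iff)
      then have step: "real a + real b \<le> real a' + c * real N powr (d - 1)"
        using wall[of n] by (simp add: N_def)
      have "c * (real N + 1) powr d \<le> c * (real N powr d + d * 2 powr d * real N powr (d - 1))"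
        using c d N by (intro mult_left_mono powr_diff_le) auto
      also have "\<dots> = c * real N powr d + (d * 2 powr d + 1) * (c * real N powr (d - 1))
          - c * real N powr (d - 1)" by (simp add: algebra_simps)
      also have "\<dots> \<le> real a'" using IH b step by linarith
      finally show ?thesis by (simp add: add.commute)
    qed
    then show ?case by (simp add: N_def a'_def add.commute)
  qed
  with c show ?thesis by (intro exI[of _ c] exI[of _ R] conjI allI impI)
qed

text \<open>Every step between the times \<open>n\<close> and \<open>(K + 1) n\<close> burns at least \<open>\<kappa>/2 n^(d-1)\<close> new vertices of
  the ball of radius \<open>6 n\<close>, which has not enough room for them.  The ball is this large because the relative
  inequality is applied in the ball of radius \<open>2 n\<close>, which contains the fire at time \<open>n\<close> as soon
  as \<open>n \<ge> R\<close>.\<close>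

lemma not_retaining:
  assumes f: "(\<lambda>n. real (f n)) \<in> o(\<lambda>n. real n powr (d - 2))"
  shows "\<not> retaining_property G S f"
proof
  assume ret: "retaining_property G S f"
  obtain c R where c: "c > 0" and spread: "\<And>W n. allowed_strategy G S f (ball R) W \<Longrightarrow>
      c * real (n + R) powr d \<le> real (card (fire G S (ball R) W n))"
    using fire_spreads_linearly[OF f] by (elim exE conjE) (rule that, auto)
  have "finite (ball R) \<and> ball R \<subseteq> carrier G" using finite_ball ball_carrier by simp
  from ret[unfolded retaining_property_def, rule_format, OF this]
  obtain c0 W where c0: "c0 > 0" and W: "allowed_strategy G S f (ball R) W"
    and ev: "\<forall>\<^sub>F n in sequentially.
      real (card (never_on_fire G S (ball R) W \<inter> ball n)) \<ge> c0 * real (growth G S n)"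
    by (elim exE conjE) (rule that, assumption+)
  obtain n0 where U: "\<And>n. n \<ge> n0 \<Longrightarrow>
      real (card (never_on_fire G S (ball R) W \<inter> ball n)) \<ge> c0 * real (growth G S n)"
    using ev unfolding eventually_sequentially by auto
  let ?F = "fire G S (ball R) W"
  \<comment> \<open>At least \<open>c n^d\<close> burnt and \<open>c0 c1 n^d\<close> safe vertices lie in the ball of radius \<open>2 n\<close>; the
      denominator is the coefficient of \<open>n^(d+1)\<close> in the upper bound for \<open>4 n |ball (4 n)|\<close>, the factor in the relative inequality.\<close>
  define \<kappa> where "\<kappa> = c * c0 * c1 / (4 * (C1 * 4 powr d))"
  have \<kappa>: "\<kappa> > 0" using c c0 c1 C1 by (simp add: \<kappa>_def)
  \<comment> \<open>A total gain of \<open>K n \<kappa>/2 n^(d-1)\<close> must exceed the bound \<open>C1 (6 n)^d\<close> on the ball.\<close>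
  obtain K :: nat where K: "real K > 2 * (C1 * 6 powr d) / \<kappa>" using reals_Archimedean2 by blast
  have "\<kappa> / 2 / real (K + 1) powr (d - 1) > 0" using \<kappa> by simp
  from total_protection_small[OF f d this]
  obtain m0 where m0: "\<And>m. m \<ge> m0 \<Longrightarrow>
      real (\<Sum>k=1..m. f k) \<le> \<kappa> / 2 / real (K + 1) powr (d - 1) * real m powr (d - 1)"
    by (auto simp: eventually_sequentially)
  define n where "n = max (max n0 m0) (max R 1)"
  have n: "n \<ge> n0" "n \<ge> m0" "n \<ge> R" "n \<ge> 1" by (auto simp: n_def)
  have wall: "real (\<Sum>k=1..m. f k) \<le> \<kappa> / 2 * real n powr (d - 1)" if "m \<le> (K + 1) * n" for m
  proof -
    have "(\<Sum>k=1..m. f k) \<le> (\<Sum>k=1..(K + 1) * n. f k)" using that by (intro sum_mono2) auto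
    then have "real (\<Sum>k=1..m. f k) \<le> real (\<Sum>k=1..(K + 1) * n. f k)" by (rule of_nat_mono)
    also have "\<dots> \<le> \<kappa> / 2 / real (K + 1) powr (d - 1) * real ((K + 1) * n) powr (d - 1)"
      using n by (intro m0) simp
    also have "real ((K + 1) * n) powr (d - 1) = real (K + 1) powr (d - 1) * real n powr (d - 1)"
      unfolding of_nat_mult by (intro powr_mult)
    also have "\<kappa> / 2 / real (K + 1) powr (d - 1) * (real (K + 1) powr (d - 1) * real n powr (d - 1))
        = \<kappa> / 2 * real n powr (d - 1)"
      by simp
    finally show ?thesis .
  qed
  have bd: "\<kappa> * real n powr (d - 1) \<le> real (card (boundary (?F m) \<inter> ball (6 * n)))"
    if m: "m \<ge> n" for m
  proof -
    define b where "b = card (boundary (?F m) \<inter> ball (6 * n))"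
    have "?F n \<subseteq> ?F m \<inter> ball (2 * n)"
      using fire_mono[OF m] fire_subset_ball[of R W n] cayley_ball_mono[of "n + R" "2 * n" G S] n
      by auto
    then have "card (?F n) \<le> card (?F m \<inter> ball (2 * n))"
      using finite_ball by (intro card_mono) auto
    then have "real (card (?F m \<inter> ball (2 * n))) \<ge> c * real (n + R) powr d"
      using spread[OF W, of n] by linarith
    moreover have "c * real (n + R) powr d \<ge> c * real n powr d"
      using c d by (intro mult_left_mono powr_mono2) auto
    ultimately have burnt: "real (card (?F m \<inter> ball (2 * n))) \<ge> c * real n powr d" by linarith
    have "card (never_on_fire G S (ball R) W \<inter> ball (2 * n)) \<le> card (ball (2 * n) - ?F m)"
      using finite_ball by (intro card_mono) (auto simp: never_on_fire_def)
    moreover have "c0 * real (growth G S (2 * n))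
        \<le> real (card (never_on_fire G S (ball R) W \<inter> ball (2 * n)))"
      using n by (intro U) auto
    moreover have "c0 * (c1 * real n powr d) \<le> c0 * real (growth G S (2 * n))"
    proof (intro mult_left_mono)
      have "c1 * real n powr d \<le> c1 * real (2 * n) powr d"
        using c1 d by (intro mult_left_mono powr_mono2) auto
      also have "\<dots> \<le> real (growth G S (2 * n))"
        unfolding growth_def using n by (intro growth_lower) auto
      finally show "c1 * real n powr d \<le> real (growth G S (2 * n))" .
    qed (use c0 in simp)
    ultimately have safe: "real (card (ball (2 * n) - ?F m)) \<ge> c0 * (c1 * real n powr d)"
      by linarith
    have "(c * real n powr d) * (c0 * (c1 * real n powr d))
        \<le> real (card (?F m \<inter> ball (2 * n))) * real (card (ball (2 * n) - ?F m))"
      using burnt safe c c0 c1 by (intro mult_mono) auto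
    also have "\<dots> \<le> real (4 * n * card (ball (4 * n)) * b)"
      using relative_isoperimetry[OF fire_carrier[OF ball_carrier], of R W m "2 * n"]
      unfolding of_nat_mult[symmetric] of_nat_le_iff b_def by simp
    also have "\<dots> = 4 * real n * real (card (ball (4 * n))) * real b" by simp
    also have "\<dots> \<le> 4 * real n * (C1 * real (4 * n) powr d) * real b"
      using n by (intro mult_right_mono mult_left_mono growth_upper) auto
    also have "\<dots> = real n powr d * (real n * (4 * (C1 * 4 powr d)) * real b)"
      by (simp add: powr_mult)
    finally have "real n powr d * (c * c0 * c1 * real n powr d)
        \<le> real n powr d * (real n * (4 * (C1 * 4 powr d)) * real b)"
      by (simp add: mult_ac)
    then have "c * c0 * c1 * real n powr d \<le> real n * (4 * (C1 * 4 powr d)) * real b"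
      using n by simp
    moreover have "real n powr d = real n * real n powr (d - 1)"
      using n by (simp add: powr_diff)
    ultimately have "real n * (c * c0 * c1 * real n powr (d - 1))
        \<le> real n * (4 * (C1 * 4 powr d) * real b)"
      by (simp add: mult_ac)
    then have "c * c0 * c1 * real n powr (d - 1) \<le> 4 * (C1 * 4 powr d) * real b"
      using n by simp
    then have "\<kappa> * real n powr (d - 1) \<le> real b"
      using C1 by (simp add: \<kappa>_def field_simps)
    then show ?thesis by (simp add: b_def)
  qed
  have "real j * (\<kappa> / 2 * real n powr (d - 1)) \<le> real (card (?F (n + j) \<inter> ball (6 * n)))"
    if "j \<le> K * n" for j
    using that
  proof (induction j)
    case (Suc j)
    have "card (?F (n + j) \<inter> ball (6 * n)) + card (boundary (?F (n + j)) \<inter> ball (6 * n))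
        \<le> card (?F (Suc (n + j)) \<inter> ball (6 * n)) + (\<Sum>k=1..Suc (n + j). f k)"
      by (rule fire_step[OF W finite_fire])
    then have "real (card (?F (n + j) \<inter> ball (6 * n))) + real (card (boundary (?F (n + j)) \<inter> ball (6 * n)))
        \<le> real (card (?F (Suc (n + j)) \<inter> ball (6 * n))) + real (\<Sum>k=1..Suc (n + j). f k)"
      by (metis of_nat_add of_nat_le_iff)
    moreover have "real (\<Sum>k=1..Suc (n + j). f k) \<le> \<kappa> / 2 * real n powr (d - 1)"
      using Suc.prems by (intro wall) auto
    moreover have "\<kappa> * real n powr (d - 1) \<le> real (card (boundary (?F (n + j)) \<inter> ball (6 * n)))"
      by (intro bd) simp
    moreover have "real j * (\<kappa> / 2 * real n powr (d - 1)) \<le> real (card (?F (n + j) \<inter> ball (6 * n)))"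
      using Suc by simp
    ultimately show ?case by (simp add: algebra_simps)
  qed simp
  from this[of "K * n"]
  have "real (K * n) * (\<kappa> / 2 * real n powr (d - 1)) \<le> real (card (?F (n + K * n) \<inter> ball (6 * n)))"
    by simp
  also have "\<dots> \<le> real (card (ball (6 * n)))"
    using finite_ball by (intro of_nat_mono card_mono) auto
  also have "\<dots> \<le> C1 * real (6 * n) powr d" using n by (intro growth_upper) auto
  also have "\<dots> = C1 * 6 powr d * real n powr d" by (simp add: powr_mult)
  also have "real (K * n) * (\<kappa> / 2 * real n powr (d - 1)) = real K * \<kappa> / 2 * real n powr d"
    using n by (simp add: powr_diff)
  finally have "real K * \<kappa> / 2 \<le> C1 * 6 powr d" using n by simp
  then have "real K \<le> 2 * (C1 * 6 powr d) / \<kappa>" using \<kappa> by (simp add: field_simps)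
  with K show False by simp
qed

end

section \<open>Slow growth\<close>

lemma (in cayley_graph) not_retaining_finite:
  assumes "finite (carrier G)" shows "\<not> retaining_property G S f"
proof
  assume "retaining_property G S f"
  from this[unfolded retaining_property_def, rule_format, OF conjI, OF assms subset_refl]
  obtain c W where c: "c > 0" and ev: "\<forall>\<^sub>F n in sequentially.
      real (card (never_on_fire G S (carrier G) W \<inter> ball n)) \<ge> c * real (growth G S n)"
    by (elim exE conjE) (rule that, assumption+)
  have "fire G S (carrier G) W 0 \<subseteq> (\<Union>n. fire G S (carrier G) W n)" by blast
  then have "never_on_fire G S (carrier G) W = {}" by (auto simp: never_on_fire_def)
  then obtain n where "c * real (growth G S n) \<le> 0"
    using ev by (auto simp: eventually_sequentially)
  moreover have "c * real (growth G S n) > 0" using c card_ball_pos by (simp add: growth_def)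
  ultimately show False by linarith
qed

lemma (in cayley_graph) finite_of_growth_less_linear:
  assumes "polynomial_growth G S d" "d < 1" shows "finite (carrier G)"
proof (rule ccontr)
  assume inf: "infinite (carrier G)"
  obtain C where C: "\<And>n. n \<ge> 1 \<Longrightarrow> real (growth G S n) / real n powr d \<le> C"
    using assms by (auto simp: polynomial_growth_def)
  have "filterlim (\<lambda>n. real n powr (1 - d)) at_top sequentially" using assms(2) by real_asymp
  then have "\<forall>\<^sub>F n in sequentially. real n powr (1 - d) > C"
    by (simp add: filterlim_at_top_dense)
  then obtain n where n: "n \<ge> 1" "real n powr (1 - d) > C"
    by (metis eventually_sequentially le_cases)
  have "real n powr (1 - d) = real n / real n powr d" using n by (simp add: powr_diff)
  also have "\<dots> \<le> real (growth G S n) / real n powr d"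
    using growth_ge_of_infinite[OF inf, of n] by (intro divide_right_mono) auto
  also have "\<dots> \<le> C" using C n by simp
  finally show False using n by simp
qed

theorem theorem1p3:
  fixes G :: "('a, 'b) monoid_scheme" and S :: "'a set" and d :: real and f :: "nat \<Rightarrow> nat"
  assumes "group G"
    and "finite S" and "S \<subseteq> carrier G"
    and "\<And>s. s \<in> S \<Longrightarrow> inv\<^bsub>G\<^esub> s \<in> S"
    and "generate G S = carrier G"
    and "polynomial_growth G S d"
    and "d \<noteq> 1"
    and "(\<lambda>n. real (f n)) \<in> o(\<lambda>n. real n powr (d - 2))"
  shows "\<not> retaining_property G S f"
proof -
  interpret cayley_graph G S
    using assms by (simp add: cayley_graph_def cayley_graph_axioms_def)
  show ?thesis
  proof (cases "d < 1")
    case True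
    then show ?thesis using assms(6) finite_of_growth_less_linear not_retaining_finite by blast
  next
    case False
    then have d: "d > 1" using assms(7) by simp
    obtain c C where *: "c > 0" "C > 0"
      "\<And>n. n \<ge> 1 \<Longrightarrow> c \<le> real (growth G S n) / real n powr d"
      "\<And>n. n \<ge> 1 \<Longrightarrow> real (growth G S n) / real n powr d \<le> C"
      using assms(6) by (auto simp: polynomial_growth_def)
    interpret polynomial_cayley_graph G S d c C
    proof
      fix n :: nat assume n: "n \<ge> 1"
      show "c * real n powr d \<le> real (card (ball n))"
        using *(3)[OF n] n by (simp add: field_simps growth_def)
      show "real (card (ball n)) \<le> C * real n powr d"
        using *(4)[OF n] n by (simp add: field_simps growth_def)
    qed (use d * in auto)
    show ?thesis using assms(8) by (rule not_retaining)
  qed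
qed

end
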